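(* (a) For a matrix $A\in\mathbb{R}^{m\times n}$ exactly one of the following two statements is true: 1. There is a solution $\vec x\in\mathbb{R}^n$ to the tropical linear system $A\odot\vec x$. 2. There is $\vec z\in\mathbb{R}^m$ such that in each row of $A^T\odot\vec z$ the minimum is attained only once and for each two rows the minimums are in different columns. (b) For a matrix $A\in\mathbb{R}_\infty^{m\times n}$ with no row and no column consisting entirely of $\infty$, exactly one of the following two statements is true: 1. There is a solution $\vec x\in\mathbb{R}_\infty^n$, $\vec x\ne(\infty,\dots,\infty)$, to the tropical linear system $A\odot\vec x$. 2. There is a finite $\vec z\in\mathbb{R}^m$ such that in each row of $A^T\odot\vec z$ the minimum is attained only once and for each two rows the minimums are in different columns. (c) For a matrix $A\in\mathbb{R}_\infty^{m\times n}$ with no row and no column consisting entirely of $\infty$, exactly one of the following two statements is true: 1. There is a finite solution $\vec x\in\mathbb{R}^n$ to the tropical linear system $A\odot\vec x$. 2. There is $\vec z\in\mathbb{R}_\infty^m$, $\vec z\ne(\infty,\dots,\infty)$, such that in each row of $A^T\odot\vec z$ the minimum is attained only once or is equal to $\infty$ and for each two rows with finite minimum the minimums are in different columns.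
   Context: $\mathbb{R}_\infty=\mathbb{R}\cup\{+\infty\}$; $m,n\ge1$. A vector $\vec x$ is a solution of the tropical linear system $A\odot\vec x$, $A=(a_{ij})$ an $m\times n$ matrix, if for each row $i$ the minimum $\min_j(a_{ij}+x_j)$ is attained for at least two different $j$ or equals $\infty$. For $\vec z\in\mathbb{R}_\infty^m$, the $i$-th row ($1\le i\le n$) of $A^T\odot\vec z$ is the family $(a_{ji}+z_j)_{1\le j\le m}$, whose members are indexed by the columns $j$ of $A^T$; the minimum in the row is the minimum of this family, and it "is in column $j$" if it is attained at $j$. *)

theory Defs
  imports "HOL-Analysis.Analysis"
begin

(* The tropical semiring R u {+oo} is the part of ereal without -oo; on it, addition and the
   order of ereal are the tropical ones. *)
definition R_inf :: "ereal set" where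
  "R_inf = {r. r \<noteq> -\<infinity>}"

definition R_inf_vecs :: "(ereal ^ 'n) set" where
  "R_inf_vecs = {x. \<forall>j. x $ j \<in> R_inf}"

definition R_inf_mats :: "(ereal ^ 'n ^ 'm) set" where
  "R_inf_mats = {A. \<forall>i j. A $ i $ j \<in> R_inf}"

definition ereal_vec :: "real ^ 'n \<Rightarrow> ereal ^ 'n" where
  "ereal_vec x = (\<chi> j. ereal (x $ j))"

definition ereal_mat :: "real ^ 'n ^ 'm \<Rightarrow> ereal ^ 'n ^ 'm" where
  "ereal_mat A = (\<chi> i j. ereal (A $ i $ j))"

definition infinity_vec :: "ereal ^ 'n" where
  "infinity_vec = (\<chi> j. \<infinity>)"

definition no_infinite_row_or_column :: "ereal ^ 'n ^ 'm \<Rightarrow> bool" where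
  "no_infinite_row_or_column A \<longleftrightarrow>
     (\<forall>i. \<exists>j. A $ i $ j \<noteq> \<infinity>) \<and> (\<forall>j. \<exists>i. A $ i $ j \<noteq> \<infinity>)"

(* The i-th row of the tropical product of A and x, kept as a family indexed by columns. *)
definition trop_row :: "ereal ^ 'n ^ 'm \<Rightarrow> ereal ^ 'n \<Rightarrow> 'm \<Rightarrow> 'n \<Rightarrow> ereal" where
  "trop_row A x i j = A $ i $ j + x $ j"

definition row_min :: "ereal ^ 'n ^ 'm \<Rightarrow> ereal ^ 'n::finite \<Rightarrow> 'm \<Rightarrow> ereal" where
  "row_min A x i = Min (range (trop_row A x i))"

definition min_in_column :: "ereal ^ 'n ^ 'm \<Rightarrow> ereal ^ 'n::finite \<Rightarrow> 'm \<Rightarrow> 'n \<Rightarrow> bool" where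
  "min_in_column A x i j \<longleftrightarrow> trop_row A x i j = row_min A x i"

definition trop_solution :: "ereal ^ 'n ^ 'm \<Rightarrow> ereal ^ 'n::finite \<Rightarrow> bool" where
  "trop_solution A x \<longleftrightarrow>
     (\<forall>i. (\<exists>j k. j \<noteq> k \<and> min_in_column A x i j \<and> min_in_column A x i k) \<or> row_min A x i = \<infinity>)"

definition unique_distinct_minima :: "ereal ^ 'n ^ 'm \<Rightarrow> ereal ^ 'n::finite \<Rightarrow> bool" where
  "unique_distinct_minima B z \<longleftrightarrow>
     (\<forall>i. \<exists>!j. min_in_column B z i j) \<and>
     (\<forall>i k. i \<noteq> k \<longrightarrow> \<not> (\<exists>j. min_in_column B z i j \<and> min_in_column B z k j))"

definition unique_distinct_finite_minima :: "ereal ^ 'n ^ 'm \<Rightarrow> ereal ^ 'n::finite \<Rightarrow> bool" where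
  "unique_distinct_finite_minima B z \<longleftrightarrow>
     (\<forall>i. (\<exists>!j. min_in_column B z i j) \<or> row_min B z i = \<infinity>) \<and>
     (\<forall>i k. i \<noteq> k \<and> row_min B z i \<noteq> \<infinity> \<and> row_min B z k \<noteq> \<infinity> \<longrightarrow>
        \<not> (\<exists>j. min_in_column B z i j \<and> min_in_column B z k j))"

end

theory Submission imports Defs begin

text \<open>A real vector \<open>x\<close> solves \<open>A \<odot> x\<close> iff for every finite entry \<open>a i j\<close> some other column
\<open>k\<close> has \<open>a i k + x k \<le> a i j + x j\<close>, that is, iff \<open>G x \<le> x\<close> for the monotone map
\<open>G x j = max\<^sub>i (min\<^sub>k\<^sub>\<noteq>\<^sub>j (a i k + x k) - a i j)\<close>, the maximum
being over the rows with \<open>a i j\<close> finite. So one raises violating coordinates: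
start from 0 and iterate \<open>x \<mapsto> min (x + 1) (max x (G x))\<close>. Let \<open>J\<close> be the set of coordinates
that grow without bound.

Off \<open>J\<close> the iterates converge, and the limit, put to \<open>\<infinity>\<close> on \<open>J\<close>, is a solution
(\<open>limit_balances\<close>). On \<open>J\<close>, from some time on, every raise of a coordinate is forced by a row
whose finite entries all lie in \<open>J\<close>, since a column with a bounded coordinate could not justify
a coordinate that is already huge. Let \<open>w\<^sub>0, ..., w\<^sub>T\<close> be such late iterates with \<open>w\<^sub>T\<close> above
\<open>w\<^sub>0\<close> on all of \<open>J\<close>; the discounted maximum \<open>y = max\<^sub>t (w\<^sub>t - t \<epsilon>)\<close> then satisfies
\<open>G y > y\<close> strictly on \<open>J\<close>: every \<open>j\<close> in \<open>J\<close> has a row \<open>\<sigma> j\<close> whose minimum under \<open>y\<close> is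
attained at \<open>j\<close> alone (\<open>escaping_strict_minima\<close>). The negated row minima of \<open>y\<close>,
increased by 1 at the rows not of the form \<open>\<sigma> j\<close>, are the vector \<open>z\<close>
(\<open>strict_minima_transpose\<close>).

One run thus yields, for every \<open>A\<close>, a solution \<open>x\<close> and a dual vector \<open>z\<close> that are strictly
complementary: \<open>x j\<close> is infinite exactly when row \<open>j\<close> of the transposed product has finite
minimum, and \<open>z i\<close> is infinite exactly when row \<open>i\<close> of \<open>A \<odot> x\<close> has finite minimum
(\<open>strictly_complementary_solutions\<close>). In each of the three alternatives this shows that one of
the two statements holds: if this \<open>x\<close> is not of the kind wanted, then \<open>z\<close> is.

Conversely, a solution \<open>x\<close> and a dual \<open>z\<close> cannot coexist when some \<open>a i j + x j + z i\<close> is finite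
(\<open>solutions_exclusive\<close>): at a pair \<open>(i, j)\<close> minimising this sum, row \<open>i\<close> of \<open>A \<odot> x\<close> attains
its minimum also at some \<open>k \<noteq> j\<close>, and then rows \<open>j\<close> and \<open>k\<close> of the transposed product both
have their minimum in column \<open>i\<close>.\<close>

section \<open>Raising violating coordinates\<close>

text \<open>The finite entries of a tropical matrix are given by their positions \<open>S\<close> and real values \<open>a\<close>.
Of the step \<open>u (Suc t) j = min (u t j + 1) (max (u t j) (G (u t) j))\<close> the definition keeps three
consequences: nothing decreases, an actual raise is justified by one row in
which \<open>j\<close> still does not exceed any competitor, and a raise of less than 1 leaves no row
violated at \<open>j\<close>. The cap 1 keeps the iterates real when a row has \<open>j\<close> as its only finite column,
where \<open>G\<close> is infinite.\<close>

definition raising_run ::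
  "('m \<Rightarrow> 'n \<Rightarrow> bool) \<Rightarrow> ('m \<Rightarrow> 'n \<Rightarrow> real) \<Rightarrow> (nat \<Rightarrow> 'n \<Rightarrow> real) \<Rightarrow> bool" where
  "raising_run S a u \<longleftrightarrow> (\<forall>t j.
     u t j \<le> u (Suc t) j \<and>
     (u (Suc t) j \<noteq> u t j \<longrightarrow>
        (\<exists>i. S i j \<and> (\<forall>k. k \<noteq> j \<and> S i k \<longrightarrow> a i j + u (Suc t) j \<le> a i k + u t k))) \<and>
     (\<forall>i. S i j \<longrightarrow> u t j + 1 \<le> u (Suc t) j \<or>
        (\<exists>k. k \<noteq> j \<and> S i k \<and> a i k + u t k \<le> a i j + u (Suc t) j)))"

definition escaping :: "(nat \<Rightarrow> 'n \<Rightarrow> real) \<Rightarrow> 'n set" where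
  "escaping u = {j. \<not> bdd_above (range (\<lambda>t. u t j))}"

text \<open>A raise determined by the most demanding row has all the properties of a step; in row \<open>i\<close>
the demand \<open>h i\<close> is the height at which \<open>j\<close> meets its lowest competitor, capped at \<open>x j + 1\<close>.\<close>

lemma ex_capped_raise:
  fixes S :: "'m::finite \<Rightarrow> 'n::finite \<Rightarrow> bool" and a :: "'m \<Rightarrow> 'n \<Rightarrow> real" and x :: "'n \<Rightarrow> real"
  shows "\<exists>v. x j \<le> v \<and>
     (v \<noteq> x j \<longrightarrow> (\<exists>i. S i j \<and> (\<forall>k. k \<noteq> j \<and> S i k \<longrightarrow> a i j + v \<le> a i k + x k))) \<and>
     (\<forall>i. S i j \<longrightarrow> x j + 1 \<le> v \<or> (\<exists>k. k \<noteq> j \<and> S i k \<and> a i k + x k \<le> a i j + v))"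
proof -
  define h where "h i = Min (insert (x j + 1) ((\<lambda>k. a i k + x k - a i j) ` {k. k \<noteq> j \<and> S i k}))" for i
  define v where "v = Max (insert (x j) (h ` {i. S i j}))"
  have "x j \<le> v" unfolding v_def by simp
  moreover have "\<exists>i. S i j \<and> (\<forall>k. k \<noteq> j \<and> S i k \<longrightarrow> a i j + v \<le> a i k + x k)" if "v \<noteq> x j"
  proof -
    have "v \<in> insert (x j) (h ` {i. S i j})" unfolding v_def by (rule Max_in) auto
    with that obtain i where i: "S i j" "v = h i" by auto
    have "h i \<le> a i k + x k - a i j" if "k \<noteq> j" "S i k" for k
      unfolding h_def using that by (intro Min_le) auto
    then show ?thesis using i by (force simp: algebra_simps)
  qed
  moreover have "x j + 1 \<le> v \<or> (\<exists>k. k \<noteq> j \<and> S i k \<and> a i k + x k \<le> a i j + v)" if "S i j" for i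
  proof -
    have "h i \<in> insert (x j + 1) ((\<lambda>k. a i k + x k - a i j) ` {k. k \<noteq> j \<and> S i k})"
      unfolding h_def by (rule Min_in) auto
    moreover have "h i \<le> v" unfolding v_def using that by (intro Max_ge) auto
    ultimately show ?thesis by force
  qed
  ultimately show ?thesis by blast
qed

lemma raising_run_exists:
  fixes S :: "'m::finite \<Rightarrow> 'n::finite \<Rightarrow> bool"
  shows "\<exists>u. raising_run S a u"
proof -
  obtain H where H: "\<And>x j. x j \<le> H x j \<and>
     (H x j \<noteq> x j \<longrightarrow> (\<exists>i. S i j \<and> (\<forall>k. k \<noteq> j \<and> S i k \<longrightarrow> a i j + H x j \<le> a i k + x k))) \<and>
     (\<forall>i. S i j \<longrightarrow> x j + 1 \<le> H x j \<or> (\<exists>k. k \<noteq> j \<and> S i k \<and> a i k + x k \<le> a i j + H x j))"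
    using ex_capped_raise[of _ _ S a] by metis
  have "raising_run S a (\<lambda>t. (H ^^ t) (\<lambda>_. 0))"
    unfolding raising_run_def funpow.simps o_apply using H by blast
  then show ?thesis by blast
qed

lemma raising_run_incseq:
  assumes "raising_run S a u"
  shows "incseq (\<lambda>t. u t j)"
  using assms unfolding raising_run_def by (intro incseq_SucI) blast

lemma bounded_coordinate_tendsto:
  assumes "raising_run S a u" and "j \<notin> escaping u"
  shows "(\<lambda>t. u t j) \<longlonglongrightarrow> (SUP t. u t j)" and "u t j \<le> (SUP t. u t j)"
  using assms raising_run_incseq[OF assms(1), of j]
  by (auto simp: escaping_def intro: LIMSEQ_incseq_SUP cSUP_upper)

lemma escaping_coordinate_at_top:
  assumes "raising_run S a u" and "j \<in> escaping u"
  shows "filterlim (\<lambda>t. u t j) at_top sequentially"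
proof -
  have "\<exists>t. c \<le> u t j" for c
    using assms(2) unfolding escaping_def bdd_above_def
    by (auto) (meson linear)
  then show ?thesis
    using raising_run_incseq[OF assms(1), of j]
    unfolding filterlim_at_top eventually_sequentially incseq_def by (meson order_trans)
qed

text \<open>The limit of the run solves the system off the escaping coordinates. If \<open>j\<close> stayed strictly
below all competitors in row \<open>i\<close> in the limit, the same would hold at all late times, escaping
competitors included, and each late step would have to raise \<open>j\<close> by the full cap 1.\<close>

lemma limit_balances:
  fixes S :: "'m::finite \<Rightarrow> 'n::finite \<Rightarrow> bool"
  assumes run: "raising_run S a u" and "S i j" and j: "j \<notin> escaping u"
  defines "L \<equiv> \<lambda>j. SUP t. u t j"
  shows "\<exists>k. k \<noteq> j \<and> S i k \<and> k \<notin> escaping u \<and> a i k + L k \<le> a i j + L j"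
proof (rule ccontr)
  assume neg: "\<not> ?thesis"
  have "\<forall>\<^sub>F t in sequentially. k \<noteq> j \<and> S i k \<longrightarrow> a i j + L j < a i k + u t k" for k
  proof (cases "k \<noteq> j \<and> S i k")
    case True
    have "\<forall>\<^sub>F t in sequentially. a i j + L j - a i k < u t k"
    proof (cases "k \<in> escaping u")
      case True
      then show ?thesis
        using escaping_coordinate_at_top[OF run] unfolding filterlim_at_top_dense by blast
    next
      case False
      then have "a i j + L j - a i k < L k" using neg True by force
      then show ?thesis
        using bounded_coordinate_tendsto(1)[OF run False] order_tendstoD(1) unfolding L_def by blast
    qed
    then show ?thesis by eventually_elim auto
  next
    case False
    then show ?thesis by (intro always_eventually) blast
  qed
  then have ev: "\<forall>\<^sub>F t in sequentially. \<forall>k. k \<noteq> j \<and> S i k \<longrightarrow> a i j + L j < a i k + u t k"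
    by (simp add: eventually_all_finite)
  have "(\<lambda>t. u (Suc t) j - u t j) \<longlonglongrightarrow> L j - L j"
    unfolding L_def by (intro tendsto_diff LIMSEQ_Suc bounded_coordinate_tendsto(1)[OF run j])
  then have "\<forall>\<^sub>F t in sequentially. u (Suc t) j - u t j < 1"
    by (auto intro: order_tendstoD(2))
  with ev have "\<forall>\<^sub>F t in sequentially. False"
  proof eventually_elim
    case (elim t)
    then obtain k where "k \<noteq> j" "S i k" "a i k + u t k \<le> a i j + u (Suc t) j"
      using run \<open>S i j\<close> unfolding raising_run_def by (smt (verit))
    then show ?case
      using elim bounded_coordinate_tendsto(2)[OF run j, of "Suc t"] unfolding L_def by force
  qed
  then show False by simp
qed

section \<open>Strict minima on the escaping coordinates\<close>

text \<open>If each escaping coordinate rises past its start, a strict certificate \<open>G y > y\<close> follows by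
discounting time: the maximum of \<open>w t j - t * e\<close> over \<open>t\<close> is attained right after a raise of
\<open>j\<close>, and the row that justified the raise compares \<open>w t j\<close> with the values one step earlier,
which are discounted by \<open>e\<close> less.\<close>

lemma escaping_strict_minima:
  fixes S :: "'m::finite \<Rightarrow> 'n::finite \<Rightarrow> bool"
  assumes run: "raising_run S a u"
  defines "J \<equiv> escaping u"
  obtains y \<sigma> where "\<And>j. j \<in> J \<Longrightarrow> S (\<sigma> j) j"
    and "\<And>j k. j \<in> J \<Longrightarrow> S (\<sigma> j) k \<Longrightarrow> k \<in> J"
    and "\<And>j k. j \<in> J \<Longrightarrow> S (\<sigma> j) k \<Longrightarrow> k \<noteq> j \<Longrightarrow> a (\<sigma> j) j + y j < a (\<sigma> j) k + y k"
proof -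
  note mono = raising_run_incseq[OF run, unfolded incseq_def]
  define L where "L j = (SUP t. u t j)" for j
  \<comment> \<open>After \<open>T0\<close>, no bounded column \<open>k\<close> can lie above an escaping column in any row. Only
    columns \<open>k\<close> with a bounded coordinate give \<open>L k\<close> this meaning.\<close>
  have "\<forall>\<^sub>F t in sequentially. j \<in> J \<longrightarrow> a i k + L k - a i j < u t j" for i j k
    using escaping_coordinate_at_top[OF run] unfolding filterlim_at_top_dense J_def
    by (cases "j \<in> escaping u") auto
  then have "\<forall>\<^sub>F t in sequentially. \<forall>i j k. j \<in> J \<longrightarrow> a i k + L k - a i j < u t j"
    by (simp add: eventually_all_finite)
  then obtain T0 where T0: "\<And>i j k. j \<in> J \<Longrightarrow> a i k + L k - a i j < u T0 j"
    unfolding eventually_sequentially by (meson order_refl)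
  have "\<forall>\<^sub>F t in sequentially. j \<in> J \<longrightarrow> u T0 j + 1 < u t j" for j
    using escaping_coordinate_at_top[OF run] unfolding filterlim_at_top_dense J_def
    by (cases "j \<in> escaping u") auto
  then have "\<forall>\<^sub>F t in sequentially. \<forall>j. j \<in> J \<longrightarrow> u T0 j + 1 < u t j"
    by (simp add: eventually_all_finite)
  then obtain T' where T': "\<And>j t. t \<ge> T' \<Longrightarrow> j \<in> J \<Longrightarrow> u T0 j + 1 < u t j"
    by (auto simp: eventually_sequentially)
  define w where "w t = u (T0 + t)" for t
  have T: "w 0 j + 1 < w T' j" if "j \<in> J" for j
    unfolding w_def using that T' by simp
  \<comment> \<open>Small enough that the total discount over \<open>T'\<close> steps does not undo the gain of 1 in \<open>T\<close>.\<close>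
  define e :: real where "e = 1 / (real T' + 1)"
  have e: "e > 0" "real T' * e < 1" unfolding e_def by (auto simp: field_simps)
  define y where "y j = Max ((\<lambda>t. w t j - real t * e) ` {..T'})" for j
  have y_ge: "w t j - real t * e \<le> y j" if "t \<le> T'" for t j
    unfolding y_def using that by (intro Max_ge) auto
  have "\<exists>i. S i j \<and> (\<forall>k. S i k \<longrightarrow> k \<in> J) \<and> (\<forall>k. S i k \<and> k \<noteq> j \<longrightarrow> a i j + y j < a i k + y k)"
    if j: "j \<in> J" for j
  proof -
    have "y j \<in> (\<lambda>t. w t j - real t * e) ` {..T'}" unfolding y_def by (rule Max_in) auto
    then obtain t where t: "t \<le> T'" "y j = w t j - real t * e" by auto
    \<comment> \<open>By the gain, and by maximality over \<open>s\<close> below, the maximum sits just after a raise.\<close>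
    have "t \<noteq> 0"
    proof
      assume "t = 0"
      then show False using T[OF j] y_ge[of T' j] t(2) e by simp
    qed
    then obtain s where s: "t = Suc s" by (cases t) auto
    have "w t j \<noteq> w s j" using y_ge[of s j] t s e by (auto simp: algebra_simps)
    then obtain i where i: "S i j" "\<And>k. k \<noteq> j \<Longrightarrow> S i k \<Longrightarrow> a i j + w t j \<le> a i k + w s k"
      using run unfolding raising_run_def w_def s by (metis add_Suc_right)
    have "k \<in> J" if "S i k" for k
    proof (rule ccontr)
      assume k: "k \<notin> J"
      then have "a i j + w t j \<le> a i k + w s k" using i(2)[of k] that j by auto
      also have "w s k \<le> L k"
        using bounded_coordinate_tendsto(2)[OF run] k unfolding w_def L_def J_def by blast
      finally show False using T0[OF j, of i k] mono[of j] unfolding w_def by (smt (verit) le_add1)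
    qed
    moreover have "a i j + y j < a i k + y k" if "S i k" "k \<noteq> j" for k
      using i(2)[OF that(2,1)] y_ge[of s k] t s e by (auto simp: algebra_simps)
    ultimately show ?thesis using i(1) by blast
  qed
  then obtain \<sigma> where "\<And>j. j \<in> J \<Longrightarrow> S (\<sigma> j) j \<and> (\<forall>k. S (\<sigma> j) k \<longrightarrow> k \<in> J) \<and>
      (\<forall>k. S (\<sigma> j) k \<and> k \<noteq> j \<longrightarrow> a (\<sigma> j) j + y j < a (\<sigma> j) k + y k)" by metis
  then show ?thesis using that[of \<sigma> y] by blast
qed

text \<open>With \<open>mu i\<close> the minimum of row \<open>i\<close> under \<open>y\<close>, every entry satisfies \<open>a i j - mu i \<ge> - y j\<close>,
with equality iff \<open>j\<close> attains the minimum of row \<open>i\<close>. So \<open>- mu\<close> makes \<open>\<sigma> j\<close> minimal in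
column \<open>j\<close>; another row \<open>\<sigma> k\<close> is not minimal there, as its minimum is attained at \<open>k\<close> only, and
adding 1 to all rows outside the image of \<open>\<sigma>\<close> breaks the remaining ties.\<close>

lemma strict_minima_transpose:
  fixes S :: "'m::finite \<Rightarrow> 'n::finite \<Rightarrow> bool" and a :: "'m \<Rightarrow> 'n \<Rightarrow> real"
  assumes S: "\<And>j. j \<in> J \<Longrightarrow> S (\<sigma> j) j"
    and min: "\<And>j k. j \<in> J \<Longrightarrow> S (\<sigma> j) k \<Longrightarrow> k \<noteq> j \<Longrightarrow> a (\<sigma> j) j + y j < a (\<sigma> j) k + y k"
  obtains z where
    "\<And>i j. j \<in> J \<Longrightarrow> S i j \<Longrightarrow> i \<noteq> \<sigma> j \<Longrightarrow> a (\<sigma> j) j + z (\<sigma> j) < a i j + z i"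
proof -
  define mu where "mu i = Min ((\<lambda>k. a i k + y k) ` {k. S i k})" for i
  define z where "z i = (if i \<in> \<sigma> ` J then 0 else 1) - mu i" for i
  have mu_le: "mu i \<le> a i k + y k" if "S i k" for i k
    unfolding mu_def using that by (intro Min_le) auto
  have mu: "mu (\<sigma> j) = a (\<sigma> j) j + y j" if j: "j \<in> J" for j
    unfolding mu_def using S[OF j] min[OF j] by (intro Min_eqI) (auto, force)
  have "a (\<sigma> j) j + z (\<sigma> j) < a i j + z i" if j: "j \<in> J" and "S i j" and i: "i \<noteq> \<sigma> j" for i j
  proof -
    have "a (\<sigma> j) j + z (\<sigma> j) = - y j" unfolding z_def using mu j by simp
    also have "- y j < a i j + z i"
    proof (cases "i \<in> \<sigma> ` J")
      case True
      then obtain k where k: "k \<in> J" "i = \<sigma> k" by blast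
      then have "j \<noteq> k" using i by blast
      then show ?thesis using min[OF k(1), of j] mu[OF k(1)] k \<open>S i j\<close> unfolding z_def by simp
    next
      case False
      then show ?thesis using mu_le[OF \<open>S i j\<close>] unfolding z_def by simp
    qed
    finally show ?thesis .
  qed
  then show ?thesis using that by blast
qed

section \<open>Strictly complementary solutions\<close>

lemma min_in_column_iff:
  "min_in_column B z i j \<longleftrightarrow> (\<forall>k. B $ i $ j + z $ j \<le> B $ i $ k + z $ k)"
proof -
  have "min_in_column B z i j \<longleftrightarrow> Min (range (trop_row B z i)) = trop_row B z i j"
    unfolding min_in_column_def row_min_def by auto
  also have "\<dots> \<longleftrightarrow> (\<forall>k. trop_row B z i j \<le> trop_row B z i k)"
    by (subst Min_eq_iff) auto
  finally show ?thesis unfolding trop_row_def .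
qed

lemma row_min_infinite_iff:
  "row_min B z i = \<infinity> \<longleftrightarrow> (\<forall>k. B $ i $ k + z $ k = \<infinity>)"
proof -
  have "row_min B z i = \<infinity> \<longleftrightarrow> (\<forall>k. \<infinity> \<le> trop_row B z i k)"
    unfolding row_min_def using Min_ge_iff[of "range (trop_row B z i)" "\<infinity>"] by auto
  then show ?thesis unfolding trop_row_def by simp
qed

text \<open>The source of every existence claim. Taking \<open>x\<close> infinite on \<open>J\<close> and \<open>z\<close> infinite on the rows
with a finite entry outside \<open>J\<close> separates the matrix into a part that only \<open>x\<close> sees and a part
that only \<open>z\<close> sees, so \<open>x\<close> need only balance the columns outside \<open>J\<close> and \<open>z\<close> only those in \<open>J\<close>.\<close>

lemma strictly_complementary_solutions:
  fixes A :: "ereal ^ 'n::finite ^ 'm::finite"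
  assumes A: "A \<in> R_inf_mats"
  obtains x z where "x \<in> R_inf_vecs" and "z \<in> R_inf_vecs"
    and "trop_solution A x" and "unique_distinct_finite_minima (transpose A) z"
    and "\<And>i. z $ i = \<infinity> \<longleftrightarrow> row_min A x i \<noteq> \<infinity>"
    and "\<And>j. x $ j = \<infinity> \<longleftrightarrow> row_min (transpose A) z j \<noteq> \<infinity>"
proof -
  define S where "S i j \<longleftrightarrow> A $ i $ j \<noteq> \<infinity>" for i j
  define a where "a i j = real_of_ereal (A $ i $ j)" for i j
  have A_eq: "A $ i $ j = (if S i j then ereal (a i j) else \<infinity>)" for i j
    using A unfolding R_inf_mats_def R_inf_def S_def a_def by (cases "A $ i $ j") auto
  obtain u where run: "raising_run S a u" using raising_run_exists by blast
  define J where "J = escaping u"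
  define L where "L j = (SUP t. u t j)" for j
  obtain y \<sigma> where \<sigma>: "\<And>j. j \<in> J \<Longrightarrow> S (\<sigma> j) j" "\<And>j k. j \<in> J \<Longrightarrow> S (\<sigma> j) k \<Longrightarrow> k \<in> J"
    "\<And>j k. j \<in> J \<Longrightarrow> S (\<sigma> j) k \<Longrightarrow> k \<noteq> j \<Longrightarrow> a (\<sigma> j) j + y j < a (\<sigma> j) k + y k"
    using escaping_strict_minima[OF run] unfolding J_def by metis
  obtain z0 where z0: "\<And>i j. j \<in> J \<Longrightarrow> S i j \<Longrightarrow> i \<noteq> \<sigma> j \<Longrightarrow> a (\<sigma> j) j + z0 (\<sigma> j) < a i j + z0 i"
    using strict_minima_transpose[of J S \<sigma> a y] \<sigma> by blast
  \<comment> \<open>A row has at most one strict minimum.\<close>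
  have inj: "j = k" if "j \<in> J" "k \<in> J" "\<sigma> j = \<sigma> k" for j k
    using \<sigma>(1,3)[of j] \<sigma>(1,3)[of k] that by (metis order.asym)
  define x :: "ereal ^ 'n" where "x = (\<chi> j. if j \<in> J then \<infinity> else ereal (L j))"
  define z :: "ereal ^ 'm" where "z = (\<chi> i. if \<forall>k. S i k \<longrightarrow> k \<in> J then ereal (z0 i) else \<infinity>)"
  have xj: "x $ j = (if j \<in> J then \<infinity> else ereal (L j))" for j unfolding x_def by simp
  have zi: "z $ i = (if \<forall>k. S i k \<longrightarrow> k \<in> J then ereal (z0 i) else \<infinity>)" for i
    unfolding z_def by simp
  have fin_x: "row_min A x i \<noteq> \<infinity> \<longleftrightarrow> (\<exists>k. S i k \<and> k \<notin> J)" for i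
    unfolding row_min_infinite_iff xj A_eq by auto
  have fin_z: "row_min (transpose A) z j \<noteq> \<infinity> \<longleftrightarrow> j \<in> J" for j
    unfolding row_min_infinite_iff zi transpose_def using \<sigma>(1,2)
    by (auto simp: A_eq split: if_splits)
  have sol: "trop_solution A x"
    unfolding trop_solution_def
  proof
    fix i
    show "(\<exists>j k. j \<noteq> k \<and> min_in_column A x i j \<and> min_in_column A x i k) \<or> row_min A x i = \<infinity>"
    proof (cases "row_min A x i = \<infinity>")
      case False
      have "row_min A x i \<in> range (trop_row A x i)" unfolding row_min_def by (rule Min_in) auto
      then obtain j where j: "min_in_column A x i j" unfolding min_in_column_def by auto
      then have "A $ i $ j + x $ j \<noteq> \<infinity>"
        using False unfolding min_in_column_def trop_row_def by simp
      then have Sj: "S i j" "j \<notin> J" unfolding A_eq xj by (auto split: if_splits)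
      then obtain k where k: "k \<noteq> j" "S i k" "k \<notin> J" "a i k + L k \<le> a i j + L j"
        using limit_balances[OF run] unfolding J_def L_def by blast
      then have "A $ i $ k + x $ k \<le> A $ i $ j + x $ j" using Sj by (simp add: A_eq xj)
      then have "min_in_column A x i k" using j unfolding min_in_column_iff by (meson order_trans)
      then show ?thesis using j k(1) by blast
    qed simp
  qed
  have col: "min_in_column (transpose A) z j i \<longleftrightarrow> i = \<sigma> j" if j: "j \<in> J" for i j
  proof -
    have less: "A $ \<sigma> j $ j + z $ \<sigma> j < A $ i $ j + z $ i" if "i \<noteq> \<sigma> j" for i
      using z0[OF j _ that] \<sigma>(1,2)[OF j] by (auto simp: A_eq zi)
    then have "A $ \<sigma> j $ j + z $ \<sigma> j \<le> A $ i $ j + z $ i" for i by (cases "i = \<sigma> j") (simp, rule less_imp_le, rule less)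
    then show ?thesis unfolding min_in_column_iff transpose_def using less
      by (auto simp: not_le[symmetric])
  qed
  have "unique_distinct_finite_minima (transpose A) z"
    unfolding unique_distinct_finite_minima_def using fin_z col inj by metis
  moreover have "x \<in> R_inf_vecs" "z \<in> R_inf_vecs"
    unfolding R_inf_vecs_def R_inf_def by (auto simp: xj zi)
  ultimately show ?thesis using that[of x z] sol fin_x fin_z by (auto simp: xj zi)
qed

section \<open>Incompatibility of the two statements\<close>

text \<open>A pair \<open>(i, j)\<close> minimising \<open>A $ i $ j + x $ j + z $ i\<close> is a minimum position both for row \<open>i\<close>
of the system and for row \<open>j\<close> of the transposed system. Sliding along row \<open>i\<close> to its second
minimum keeps the sum and so gives a second transposed row with its minimum in column \<open>i\<close>.\<close>

lemma solutions_exclusive: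
  fixes A :: "ereal ^ 'n::finite ^ 'm::finite"
  assumes A: "A \<in> R_inf_mats" and x: "x \<in> R_inf_vecs" and z: "z \<in> R_inf_vecs"
    and sol: "trop_solution A x" and dual: "unique_distinct_finite_minima (transpose A) z"
    and fin: "A $ i0 $ j0 \<noteq> \<infinity>" "x $ j0 \<noteq> \<infinity>" "z $ i0 \<noteq> \<infinity>"
  shows False
proof -
  define c where "c p = A $ fst p $ snd p + x $ snd p + z $ fst p" for p
  have "\<exists>p. c p = Min (range c)" using Min_in[of "range c"] by (metis UNIV_not_empty finite
        image_is_empty finite_imageI rangeE)
  then obtain i j where ij: "\<And>k l. c (i, j) \<le> c (k, l)"
    by (metis Min_le finite finite_imageI rangeI surj_pair)
  have finA: "A $ k $ l \<noteq> -\<infinity>" "x $ l \<noteq> -\<infinity>" "z $ k \<noteq> -\<infinity>" for k l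
    using A x z unfolding R_inf_mats_def R_inf_vecs_def R_inf_def by auto
  have "c (i, j) \<noteq> \<infinity>" using ij[of i0 j0] fin unfolding c_def by auto
  then have fij: "A $ i $ j \<noteq> \<infinity>" "x $ j \<noteq> \<infinity>" "z $ i \<noteq> \<infinity>" unfolding c_def by auto
  have col: "min_in_column (transpose A) z l i" "row_min (transpose A) z l \<noteq> \<infinity>"
    if eq: "c (i, l) = c (i, j)" for l
  proof -
    have "c (i, l) \<noteq> \<infinity>" using eq \<open>c (i, j) \<noteq> \<infinity>\<close> by simp
    then have f: "A $ i $ l \<noteq> \<infinity>" "x $ l \<noteq> \<infinity>" unfolding c_def by auto
    have "x $ l + (A $ i $ l + z $ i) \<le> x $ l + (A $ k $ l + z $ k)" for k
      using ij[of k l] unfolding eq[symmetric] by (simp add: c_def ac_simps)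
    then have "A $ i $ l + z $ i \<le> A $ k $ l + z $ k" for k
      using f(2) finA(2)[of l] by (simp add: ereal_add_le_add_iff)
    then show "min_in_column (transpose A) z l i"
      unfolding min_in_column_iff by (simp add: transpose_def)
    show "row_min (transpose A) z l \<noteq> \<infinity>"
      unfolding row_min_infinite_iff using f fij by (auto simp: transpose_def)
  qed
  have "z $ i + (A $ i $ j + x $ j) \<le> z $ i + (A $ i $ l + x $ l)" for l
    using ij[of i l] by (simp add: c_def ac_simps)
  then have row: "A $ i $ j + x $ j \<le> A $ i $ l + x $ l" for l
    using fij(3) finA(3)[of i] by (simp add: ereal_add_le_add_iff)
  have "row_min A x i \<noteq> \<infinity>" unfolding row_min_infinite_iff using fij by auto
  then obtain l where l: "l \<noteq> j" "min_in_column A x i l"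
    using sol unfolding trop_solution_def by metis
  then have "A $ i $ l + x $ l = A $ i $ j + x $ j"
    using row unfolding min_in_column_iff by (auto intro: antisym)
  then have "c (i, l) = c (i, j)" unfolding c_def by simp
  then show False
    using col[of l] col[of j] l(1) dual unfolding unique_distinct_finite_minima_def by blast
qed

section \<open>The three alternatives\<close>

lemma unique_distinct_minima_finite_iff:
  assumes "\<And>i. row_min B z i \<noteq> \<infinity>"
  shows "unique_distinct_minima B z \<longleftrightarrow> unique_distinct_finite_minima B z"
  using assms unfolding unique_distinct_minima_def unique_distinct_finite_minima_def by simp

lemma ereal_vec_in_R_inf_vecs: "ereal_vec z \<in> R_inf_vecs"
  unfolding ereal_vec_def R_inf_vecs_def R_inf_def by simp

lemma finite_vec_is_ereal_vec:
  assumes "z \<in> R_inf_vecs" and "\<And>i. z $ i \<noteq> \<infinity>"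
  shows "\<exists>r. z = ereal_vec r"
proof
  have "z $ i \<noteq> -\<infinity>" for i
    using assms(1) unfolding R_inf_vecs_def R_inf_def by blast
  then have "z $ i = ereal (real_of_ereal (z $ i))" for i
    using assms(2) by (metis real_of_ereal.elims real_of_ereal.simps(1))
  then show "z = ereal_vec (\<chi> i. real_of_ereal (z $ i))"
    unfolding ereal_vec_def by (simp add: vec_eq_iff)
qed

lemma row_min_transpose_finite:
  assumes "no_infinite_row_or_column A"
  shows "row_min (transpose A) (ereal_vec z) j \<noteq> \<infinity>"
  using assms unfolding row_min_infinite_iff no_infinite_row_or_column_def ereal_vec_def transpose_def
  by auto

text \<open>In the strictly complementary pair, \<open>x\<close> being infinite everywhere makes every row minimum of
\<open>A \<odot> x\<close> infinite, hence \<open>z\<close> finite everywhere.\<close>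

lemma alternative_finite_dual:
  fixes A :: "ereal ^ 'n::finite ^ 'm::finite"
  assumes A: "A \<in> R_inf_mats" and no: "no_infinite_row_or_column A"
  shows "(\<exists>x \<in> R_inf_vecs. x \<noteq> infinity_vec \<and> trop_solution A x) \<longleftrightarrow>
    \<not> (\<exists>z. unique_distinct_minima (transpose A) (ereal_vec z))"
proof (intro iffI notI)
  assume "\<exists>x \<in> R_inf_vecs. x \<noteq> infinity_vec \<and> trop_solution A x"
    and "\<exists>z. unique_distinct_minima (transpose A) (ereal_vec z)"
  then obtain x z where x: "x \<in> R_inf_vecs" "x \<noteq> infinity_vec" "trop_solution A x"
    and z: "unique_distinct_finite_minima (transpose A) (ereal_vec z)"
    using unique_distinct_minima_finite_iff row_min_transpose_finite[OF no] by blast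
  obtain j where j: "x $ j \<noteq> \<infinity>" using x(2) unfolding infinity_vec_def by (auto simp: vec_eq_iff)
  obtain i where "A $ i $ j \<noteq> \<infinity>" using no unfolding no_infinite_row_or_column_def by blast
  then show False
    using solutions_exclusive[OF A x(1) ereal_vec_in_R_inf_vecs x(3) z _ j]
    by (simp add: ereal_vec_def)
next
  assume nz: "\<nexists>z. unique_distinct_minima (transpose A) (ereal_vec z)"
  obtain x z where xz: "x \<in> R_inf_vecs" "z \<in> R_inf_vecs"
    "trop_solution A x" "unique_distinct_finite_minima (transpose A) z"
    "\<And>i. z $ i = \<infinity> \<longleftrightarrow> row_min A x i \<noteq> \<infinity>"
    using strictly_complementary_solutions[OF A] by metis
  have "x \<noteq> infinity_vec"
  proof
    assume "x = infinity_vec"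
    then have "z $ i \<noteq> \<infinity>" for i
      unfolding xz(5) by (simp add: row_min_infinite_iff infinity_vec_def)
    then obtain r where "z = ereal_vec r" using finite_vec_is_ereal_vec xz(2) by blast
    then show False
      using nz xz(4) unique_distinct_minima_finite_iff row_min_transpose_finite[OF no] by blast
  qed
  then show "\<exists>x \<in> R_inf_vecs. x \<noteq> infinity_vec \<and> trop_solution A x" using xz by blast
qed

text \<open>Dually, \<open>z\<close> being infinite everywhere makes \<open>x\<close> finite everywhere.\<close>

lemma alternative_finite_primal:
  fixes A :: "ereal ^ 'n::finite ^ 'm::finite"
  assumes A: "A \<in> R_inf_mats" and no: "no_infinite_row_or_column A"
  shows "(\<exists>x. trop_solution A (ereal_vec x)) \<longleftrightarrow>
    \<not> (\<exists>z \<in> R_inf_vecs. z \<noteq> infinity_vec \<and> unique_distinct_finite_minima (transpose A) z)"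
proof (intro iffI notI)
  assume "\<exists>x. trop_solution A (ereal_vec x)"
    and "\<exists>z \<in> R_inf_vecs. z \<noteq> infinity_vec \<and> unique_distinct_finite_minima (transpose A) z"
  then obtain x z where x: "trop_solution A (ereal_vec x)"
    and z: "z \<in> R_inf_vecs" "z \<noteq> infinity_vec" "unique_distinct_finite_minima (transpose A) z"
    by blast
  obtain i where i: "z $ i \<noteq> \<infinity>" using z(2) unfolding infinity_vec_def by (auto simp: vec_eq_iff)
  obtain j where "A $ i $ j \<noteq> \<infinity>" using no unfolding no_infinite_row_or_column_def by blast
  then show False
    using solutions_exclusive[OF A ereal_vec_in_R_inf_vecs z(1) x z(3) _ _ i]
    by (simp add: ereal_vec_def)
next
  assume nz: "\<not> (\<exists>z \<in> R_inf_vecs. z \<noteq> infinity_vec \<and> unique_distinct_finite_minima (transpose A) z)"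
  obtain x z where xz: "x \<in> R_inf_vecs" "z \<in> R_inf_vecs"
    "trop_solution A x" "unique_distinct_finite_minima (transpose A) z"
    "\<And>j. x $ j = \<infinity> \<longleftrightarrow> row_min (transpose A) z j \<noteq> \<infinity>"
    using strictly_complementary_solutions[OF A] by metis
  have "z = infinity_vec" using nz xz by blast
  then have "x $ j \<noteq> \<infinity>" for j
    unfolding xz(5) by (simp add: row_min_infinite_iff infinity_vec_def)
  then show "\<exists>x. trop_solution A (ereal_vec x)" using finite_vec_is_ereal_vec xz by metis
qed

text \<open>Without infinite entries complementarity is all or nothing: one infinite \<open>x $ j\<close> gives a finite
\<open>z $ i\<close>, so row \<open>i\<close> of \<open>A \<odot> x\<close> is infinite, which forces all of \<open>x\<close> to be infinite and hence
all of \<open>z\<close> to be finite.\<close>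

lemma alternative_real_matrix:
  fixes A :: "real ^ 'n::finite ^ 'm::finite"
  shows "(\<exists>x. trop_solution (ereal_mat A) (ereal_vec x)) \<longleftrightarrow>
    \<not> (\<exists>z. unique_distinct_minima (transpose (ereal_mat A)) (ereal_vec z))"
proof -
  let ?A = "ereal_mat A"
  have A: "?A \<in> R_inf_mats" and no: "no_infinite_row_or_column ?A"
    unfolding R_inf_mats_def R_inf_def no_infinite_row_or_column_def ereal_mat_def by auto
  note alt = alternative_finite_dual[OF A no]
  show ?thesis
  proof
    assume "\<exists>x. trop_solution ?A (ereal_vec x)"
    then obtain x where x: "trop_solution ?A (ereal_vec x)" ..
    have "ereal_vec x \<noteq> infinity_vec"
      unfolding ereal_vec_def infinity_vec_def by (simp add: vec_eq_iff)
    with x show "\<not> (\<exists>z. unique_distinct_minima (transpose ?A) (ereal_vec z))"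
      using alt ereal_vec_in_R_inf_vecs by blast
  next
    assume nz: "\<not> (\<exists>z. unique_distinct_minima (transpose ?A) (ereal_vec z))"
    obtain x z where xz: "x \<in> R_inf_vecs" "z \<in> R_inf_vecs"
      "trop_solution ?A x" "unique_distinct_finite_minima (transpose ?A) z"
      "\<And>i. z $ i = \<infinity> \<longleftrightarrow> row_min ?A x i \<noteq> \<infinity>"
      "\<And>j. x $ j = \<infinity> \<longleftrightarrow> row_min (transpose ?A) z j \<noteq> \<infinity>"
      using strictly_complementary_solutions[OF A] by metis
    have "x $ j \<noteq> \<infinity>" for j
    proof
      assume "x $ j = \<infinity>"
      then obtain i where "z $ i \<noteq> \<infinity>"
        unfolding xz(6) by (auto simp: row_min_infinite_iff)
      then have "x $ k = \<infinity>" for k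
        unfolding xz(5) by (simp add: row_min_infinite_iff ereal_mat_def)
      then have "z $ i \<noteq> \<infinity>" for i
        unfolding xz(5) by (simp add: row_min_infinite_iff)
      then obtain r where "z = ereal_vec r" using finite_vec_is_ereal_vec xz(2) by blast
      then show False
        using nz xz(4) unique_distinct_minima_finite_iff row_min_transpose_finite[OF no] by blast
    qed
    then show "\<exists>x. trop_solution ?A (ereal_vec x)"
      using finite_vec_is_ereal_vec xz(1,3) by metis
  qed
qed

theorem corollary15:
  "(\<forall>A :: real ^ 'n::finite ^ 'm::finite.
      (\<exists>x :: real ^ 'n. trop_solution (ereal_mat A) (ereal_vec x)) \<longleftrightarrow>
      \<not> (\<exists>z :: real ^ 'm. unique_distinct_minima (transpose (ereal_mat A)) (ereal_vec z)))
   \<and>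
   (\<forall>A :: ereal ^ 'n ^ 'm. A \<in> R_inf_mats \<and> no_infinite_row_or_column A \<longrightarrow>
      ((\<exists>x \<in> R_inf_vecs. x \<noteq> infinity_vec \<and> trop_solution A x) \<longleftrightarrow>
       \<not> (\<exists>z :: real ^ 'm. unique_distinct_minima (transpose A) (ereal_vec z))))
   \<and>
   (\<forall>A :: ereal ^ 'n ^ 'm. A \<in> R_inf_mats \<and> no_infinite_row_or_column A \<longrightarrow>
      ((\<exists>x :: real ^ 'n. trop_solution A (ereal_vec x)) \<longleftrightarrow>
       \<not> (\<exists>z \<in> R_inf_vecs. z \<noteq> infinity_vec \<and>
             unique_distinct_finite_minima (transpose A) z)))"
  using alternative_real_matrix alternative_finite_dual alternative_finite_primal by blast

end
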